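(* Let $K$ be a field and let $\mathcal P$ and $\mathcal Q$ be finite posets. The following conditions are equivalent: (a) the ideal $L(\mathcal P,\mathcal Q)$ is rigid; (b) no two distinct elements of $\mathcal P$ are comparable.
   Context: A map $\varphi:\mathcal P\to\mathcal Q$ of posets is isotone if $p\le p'$ implies $\varphi(p)\le\varphi(p')$; $\mathrm{Hom}(\mathcal P,\mathcal Q)$ is the set of isotone maps. Let $S$ be the polynomial ring over $K$ in the variables $x_{p,q}$, $p\in\mathcal P$, $q\in\mathcal Q$. $L(\mathcal P,\mathcal Q)\subseteq S$ is the monomial ideal generated by the monomials $u_\varphi=\prod_{p\in\mathcal P}x_{p,\varphi(p)}$ with $\varphi\in\mathrm{Hom}(\mathcal P,\mathcal Q)$. For an ideal $I\subseteq S$, $T^1(S/I)$ is the cokernel of the map $\delta^*:\mathrm{Der}_K(S)\to\mathrm{Hom}_S(I,S/I)$, $\delta^*(\partial)(f)=\partial f+I$, where $\mathrm{Der}_K(S)$ is the module of $K$-derivations $S\to S$. $I$ is called rigid if $T^1(S/I)=0$.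
   Formalization: The formal theorem assumes Q has at least two elements; the statement fails otherwise: for |Q|=1 and P a two-element antichain, L=(xy) is not rigid, and for Q empty and P not an antichain, L=0 is rigid. *)

theory Defs
  imports
    "HOL-Library.Poly_Mapping"
    "HOL-Algebra.QuotRing"
    "HOL-Algebra.Elementary_Groups"
begin

text \<open>
  A polynomial over \<open>'k\<close> is a finitely supported map from monomials to coefficients, and a monomial
  is a finitely supported map from variables to exponents.
\<close>

type_synonym ('v, 'k) mpoly = "('v \<Rightarrow>\<^sub>0 nat) \<Rightarrow>\<^sub>0 'k"

definition Cst :: "'k::field \<Rightarrow> ('v, 'k) mpoly" where
  "Cst c = Poly_Mapping.single 0 c"

definition X :: "'v \<Rightarrow> ('v, 'k::field) mpoly" where
  "X v = Poly_Mapping.single (Poly_Mapping.single v 1) 1"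

text \<open>The polynomial ring in the variables from \<open>V\<close>, where \<open>V\<close> need not exhaust the type \<open>'v\<close>.\<close>

definition poly_ring :: "'v set \<Rightarrow> ('v, 'k::field) mpoly ring" where
  "poly_ring V = \<lparr>carrier = {f. \<forall>m \<in> Poly_Mapping.keys f. Poly_Mapping.keys m \<subseteq> V},
     mult = (*), one = 1, zero = 0, add = (+)\<rparr>"

definition isotone_maps :: "'p::order set \<Rightarrow> 'q::order set \<Rightarrow> ('p \<Rightarrow> 'q) set" where
  "isotone_maps P Q = {\<phi> \<in> P \<rightarrow>\<^sub>E Q. mono_on P \<phi>}"

definition isotone_monomial :: "'p set \<Rightarrow> ('p \<Rightarrow> 'q) \<Rightarrow> ('p \<times> 'q, 'k::field) mpoly" where
  "isotone_monomial P \<phi> = (\<Prod>p\<in>P. X (p, \<phi> p))"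

definition isotone_ideal :: "'p::order set \<Rightarrow> 'q::order set \<Rightarrow> ('p \<times> 'q, 'k::field) mpoly set" where
  "isotone_ideal P Q =
     Idl\<^bsub>poly_ring (P \<times> Q)\<^esub> (isotone_monomial P ` isotone_maps P Q)"

definition derivations :: "'v set \<Rightarrow> (('v, 'k::field) mpoly \<Rightarrow> ('v, 'k) mpoly) set" where
  "derivations V = (let S = carrier (poly_ring V) in
     {D \<in> S \<rightarrow>\<^sub>E S.
        (\<forall>f\<in>S. \<forall>g\<in>S. D (f + g) = D f + D g) \<and>
        (\<forall>c. \<forall>f\<in>S. D (Cst c * f) = Cst c * D f) \<and>
        (\<forall>f\<in>S. \<forall>g\<in>S. D (f * g) = f * D g + g * D f)})"

text \<open>
  The \<open>R\<close>-linear maps \<open>I \<rightarrow> R/I\<close>. Elements of \<open>R Quot I\<close> are cosets, and \<open>a \<in> R\<close> acts on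
  \<open>R Quot I\<close> as multiplication by the coset of \<open>a\<close>.
\<close>

definition Hom_quot :: "'a ring \<Rightarrow> 'a set \<Rightarrow> ('a \<Rightarrow> 'a set) set" where
  "Hom_quot R I = {h \<in> I \<rightarrow>\<^sub>E carrier (R Quot I).
     (\<forall>f\<in>I. \<forall>g\<in>I. h (f \<oplus>\<^bsub>R\<^esub> g) = h f \<oplus>\<^bsub>R Quot I\<^esub> h g) \<and>
     (\<forall>a\<in>carrier R. \<forall>f\<in>I. h (a \<otimes>\<^bsub>R\<^esub> f) = (I +>\<^bsub>R\<^esub> a) \<otimes>\<^bsub>R Quot I\<^esub> h f)}"

definition Hom_quot_group :: "'a ring \<Rightarrow> 'a set \<Rightarrow> ('a \<Rightarrow> 'a set) monoid" where
  "Hom_quot_group R I = \<lparr>carrier = Hom_quot R I,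
     mult = (\<lambda>h k. \<lambda>f\<in>I. h f \<oplus>\<^bsub>R Quot I\<^esub> k f),
     one = (\<lambda>f\<in>I. \<zero>\<^bsub>R Quot I\<^esub>)\<rparr>"

definition delta_star ::
  "'v set \<Rightarrow> ('v, 'k::field) mpoly set \<Rightarrow> (('v, 'k) mpoly \<Rightarrow> ('v, 'k) mpoly)
     \<Rightarrow> (('v, 'k) mpoly \<Rightarrow> ('v, 'k) mpoly set)" where
  "delta_star V I D = (\<lambda>f\<in>I. I +>\<^bsub>poly_ring V\<^esub> D f)"

text \<open>
  Only the additive group of the cokernel is recorded: the scalar multiplication plays no role in
  whether the module vanishes.
\<close>

definition T1 :: "'v set \<Rightarrow> ('v, 'k::field) mpoly set \<Rightarrow> (('v, 'k) mpoly \<Rightarrow> ('v, 'k) mpoly set) set monoid"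
  where "T1 V I = Hom_quot_group (poly_ring V) I Mod (delta_star V I ` derivations V)"

definition rigid :: "'v set \<Rightarrow> ('v, 'k::field) mpoly set \<Rightarrow> bool" where
  "rigid V I \<longleftrightarrow> trivial_group (T1 V I)"

end

theory Submission
  imports Defs
begin

text \<open>
  Suppose \<open>p < p'\<close> in \<open>P\<close>, let \<open>a\<close> be minimal in \<open>Q\<close>, put \<open>b = x\<^bsub>p,a\<^esub> x\<^bsub>p',a\<^esub>\<close>, and let \<open>w\<close> be the
  product of all variables except \<open>x\<^bsub>p,a\<^esub>\<close> and those of row \<open>p'\<close>. Sending a monomial \<open>m\<close> of the
  ideal to \<open>w m / b\<close> if \<open>b\<close> divides \<open>m\<close>, and to \<open>0\<close> otherwise, is linear modulo the ideal: if \<open>b\<close>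
  divides \<open>t m\<close> but not \<open>m\<close>, then \<open>m\<close> involves \<open>x\<^bsub>p',c\<^esub>\<close> for some \<open>c \<noteq> a\<close>, so that
  \<open>w t m / b\<close> is divisible by the monomial of the constant map \<open>c\<close>. At the monomial of the constant
  map \<open>a\<close>, every derivation takes a value in \<open>(x\<^bsub>p,a\<^esub>, x\<^bsub>p',a\<^esub>)\<close>, whereas this homomorphism yields a
  monomial that lies neither there nor in the ideal.

  If \<open>P\<close> is an antichain, the ideal is the intersection over \<open>p\<close> of the primes generated by the
  variables of row \<open>p\<close>. Let \<open>h\<close> map the monomial of \<open>\<phi>\<close> to the class of \<open>g\<^sub>\<phi>\<close>. Modulo the prime
  of row \<open>p\<^sub>0\<close>, exchanging one value of \<open>\<phi>\<close> shows that \<open>g\<^sub>\<phi>\<close> is divisible by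
  \<open>\<Prod>p\<noteq>p\<^sub>0. x\<^bsub>p,\<phi>(p)\<^esub>\<close>, and that the quotient depends only on \<open>p\<^sub>0\<close> and \<open>\<phi>(p\<^sub>0)\<close>. These
  quotients are the values on the variables of a derivation that induces \<open>h\<close>.
\<close>

subsection \<open>Homomorphisms into a quotient ring\<close>

lemma Hom_quot_comm_group:
  assumes "cring R" "ideal I R"
  shows "comm_group (Hom_quot_group R I)"
proof -
  interpret R: cring R by fact
  interpret I: ideal I R by fact
  interpret Q: cring "R Quot I" by (rule I.quotient_is_cring) fact
  have coset: "I +>\<^bsub>R\<^esub> a \<in> carrier (R Quot I)" if "a \<in> carrier R" for a
    using I.rcos_ring_hom that by (auto dest: ring_hom_closed)
  have I_add: "f \<oplus>\<^bsub>R\<^esub> g \<in> I" if "f \<in> I" "g \<in> I" for f g using that by auto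
  have I_mult: "a \<otimes>\<^bsub>R\<^esub> f \<in> I" if "f \<in> I" "a \<in> carrier R" for f a
    using that by (rule I.I_l_closed)
  have mem: "h f \<in> carrier (R Quot I)" if "h \<in> Hom_quot R I" "f \<in> I" for h f
    using that by (auto simp: Hom_quot_def)
  show ?thesis
  proof (rule comm_groupI)
    fix x y assume xy: "x \<in> carrier (Hom_quot_group R I)" "y \<in> carrier (Hom_quot_group R I)"
    then have "x \<in> Hom_quot R I" "y \<in> Hom_quot R I" by (auto simp: Hom_quot_group_def)
    then show "x \<otimes>\<^bsub>Hom_quot_group R I\<^esub> y \<in> carrier (Hom_quot_group R I)"
      unfolding Hom_quot_group_def
      by (auto simp: Hom_quot_def I_add I_mult Pi_def coset Q.r_distr PiE_def Q.a_ac)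
    show "x \<otimes>\<^bsub>Hom_quot_group R I\<^esub> y = y \<otimes>\<^bsub>Hom_quot_group R I\<^esub> x"
      using xy by (auto simp: Hom_quot_group_def mem fun_eq_iff Q.a_comm restrict_def)
  next
    show "\<one>\<^bsub>Hom_quot_group R I\<^esub> \<in> carrier (Hom_quot_group R I)"
      by (auto simp: Hom_quot_group_def Hom_quot_def I_add I_mult coset)
  next
    fix x y z assume "x \<in> carrier (Hom_quot_group R I)" "y \<in> carrier (Hom_quot_group R I)"
      "z \<in> carrier (Hom_quot_group R I)"
    then show "x \<otimes>\<^bsub>Hom_quot_group R I\<^esub> y \<otimes>\<^bsub>Hom_quot_group R I\<^esub> z =
      x \<otimes>\<^bsub>Hom_quot_group R I\<^esub> (y \<otimes>\<^bsub>Hom_quot_group R I\<^esub> z)"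
      by (auto simp: Hom_quot_group_def mem fun_eq_iff Q.a_assoc)
  next
    fix x assume x: "x \<in> carrier (Hom_quot_group R I)"
    then have xH: "x \<in> Hom_quot R I" by (simp add: Hom_quot_group_def)
    then have ext: "x f = undefined" if "f \<notin> I" for f
      using that by (auto simp: Hom_quot_def)
    show "\<one>\<^bsub>Hom_quot_group R I\<^esub> \<otimes>\<^bsub>Hom_quot_group R I\<^esub> x = x"
      using xH by (auto simp: Hom_quot_group_def mem fun_eq_iff ext restrict_def)
    let ?y = "\<lambda>f\<in>I. \<ominus>\<^bsub>R Quot I\<^esub> x f"
    have "?y \<in> carrier (Hom_quot_group R I)"
      using xH unfolding Hom_quot_group_def
      by (auto simp: Hom_quot_def I_add I_mult Pi_def coset Q.minus_add Q.r_minus PiE_def Q.a_ac)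
    moreover have "?y \<otimes>\<^bsub>Hom_quot_group R I\<^esub> x = \<one>\<^bsub>Hom_quot_group R I\<^esub>"
      using xH by (auto simp: Hom_quot_group_def mem fun_eq_iff Q.l_neg restrict_def)
    ultimately show "\<exists>y\<in>carrier (Hom_quot_group R I). y \<otimes>\<^bsub>Hom_quot_group R I\<^esub> x = \<one>\<^bsub>Hom_quot_group R I\<^esub>"
      by blast
  qed
qed

text \<open>The unit of \<open>G Mod H\<close> is \<open>H\<close> itself, so triviality says that
  every coset equals \<open>H\<close>; as \<open>\<one>\<close> lies in \<open>H\<close>, each
  \<open>x\<close> lies in its own coset and hence in \<open>H\<close>. \<open>H\<close> is a mere
  subset here so that the image of \<open>delta_star\<close> can be inserted directly.\<close>

lemma (in group) trivial_group_Mod_iff: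
  assumes "H \<subseteq> carrier G" "\<one> \<in> H"
  shows "trivial_group (G Mod H) \<longleftrightarrow> H = carrier G"
proof
  assume "trivial_group (G Mod H)"
  then have *: "rcosets H = {H}" by (simp add: trivial_group_def FactGroup_def)
  have "x \<in> H" if "x \<in> carrier G" for x
  proof -
    have "H #> x = H" using * that by (auto simp: RCOSETS_def)
    moreover have "\<one> \<otimes> x \<in> H #> x" using assms(2) by (auto simp: r_coset_def)
    ultimately show ?thesis using that by simp
  qed
  then show "H = carrier G" using assms(1) by auto
next
  assume H: "H = carrier G"
  have "normal (carrier G) G"
    by (rule normal_invI[OF subgroup_self]) auto
  then have "group (G Mod H)" using H normal.factorgroup_is_group by blast
  moreover have "rcosets H = {H}"
    unfolding H RCOSETS_def using coset_join2[OF _ subgroup_self] by auto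
  ultimately show "trivial_group (G Mod H)" by (simp add: trivial_group_def FactGroup_def)
qed

lemma Hom_quot_smult:
  "h \<in> Hom_quot R I \<Longrightarrow> a \<in> carrier R \<Longrightarrow> f \<in> I \<Longrightarrow>
    h (a \<otimes>\<^bsub>R\<^esub> f) = (I +>\<^bsub>R\<^esub> a) \<otimes>\<^bsub>R Quot I\<^esub> h f"
  by (simp add: Hom_quot_def)

lemma (in ideal) a_r_coset_eq_iff:
  assumes "x \<in> carrier R" "y \<in> carrier R"
  shows "I +> x = I +> y \<longleftrightarrow> x \<ominus> y \<in> I"
  using assms by (metis a_rcos_module_minus a_rcos_self a_repr_independence' ring_axioms)

text \<open>The elements on which \<open>h\<close> and \<open>k\<close> agree form an ideal, and
  this ideal contains the generators.\<close>

lemma Hom_quot_eqI: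
  assumes "cring R" "A \<subseteq> carrier R"
    and h: "h \<in> Hom_quot R (Idl\<^bsub>R\<^esub> A)" and k: "k \<in> Hom_quot R (Idl\<^bsub>R\<^esub> A)"
    and eq: "\<And>a. a \<in> A \<Longrightarrow> h a = k a"
  shows "h = k"
proof -
  interpret R: cring R by fact
  let ?I = "Idl\<^bsub>R\<^esub> A"
  interpret I: ideal ?I R by (rule R.genideal_ideal) fact
  interpret Q: cring "R Quot ?I" by (rule I.quotient_is_cring) fact
  let ?J = "{f \<in> ?I. h f = k f}"
  have mem: "h f \<in> carrier (R Quot ?I)" if "f \<in> ?I" for f
    using that h by (auto simp: Hom_quot_def)
  have mult: "h (a \<otimes>\<^bsub>R\<^esub> f) = k (a \<otimes>\<^bsub>R\<^esub> f)" if "a \<in> carrier R" "f \<in> ?J" for a f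
    using that h k by (auto simp: Hom_quot_def)
  have add: "h (f \<oplus>\<^bsub>R\<^esub> g) = k (f \<oplus>\<^bsub>R\<^esub> g)" if "f \<in> ?J" "g \<in> ?J" for f g
    using that h k by (auto simp: Hom_quot_def)
  have lclosed: "a \<otimes>\<^bsub>R\<^esub> f \<in> ?J" if "a \<in> carrier R" "f \<in> ?J" for a f
    using that mult I.I_l_closed by auto
  \<comment> \<open>Linearity with the scalar zero makes both maps vanish at zero, because the coset
    of zero is the zero of the quotient.\<close>
  have zero: "\<zero>\<^bsub>R\<^esub> \<in> ?J"
  proof -
    have "h (\<zero>\<^bsub>R\<^esub> \<otimes>\<^bsub>R\<^esub> \<zero>\<^bsub>R\<^esub>) = (?I +>\<^bsub>R\<^esub> \<zero>\<^bsub>R\<^esub>) \<otimes>\<^bsub>R Quot ?I\<^esub> h \<zero>\<^bsub>R\<^esub>"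
      "k (\<zero>\<^bsub>R\<^esub> \<otimes>\<^bsub>R\<^esub> \<zero>\<^bsub>R\<^esub>) = (?I +>\<^bsub>R\<^esub> \<zero>\<^bsub>R\<^esub>) \<otimes>\<^bsub>R Quot ?I\<^esub> k \<zero>\<^bsub>R\<^esub>"
      using Hom_quot_smult[OF h] Hom_quot_smult[OF k] by (metis R.zero_closed I.zero_closed)+
    moreover have "?I +>\<^bsub>R\<^esub> \<zero>\<^bsub>R\<^esub> = \<zero>\<^bsub>R Quot ?I\<^esub>"
      using I.a_rcos_const[OF I.zero_closed] by (simp add: FactRing_def)
    moreover have "h \<zero>\<^bsub>R\<^esub> \<in> carrier (R Quot ?I)" "k \<zero>\<^bsub>R\<^esub> \<in> carrier (R Quot ?I)"
      using h k unfolding Hom_quot_def by auto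
    ultimately show ?thesis by simp
  qed
  have "ideal ?J R"
  proof (rule idealI)
    show "subgroup ?J (add_monoid R)"
    proof (rule R.add.subgroupI)
      show "?J \<noteq> {}" using zero by blast
      fix f assume f: "f \<in> ?J"
      have "(\<ominus>\<^bsub>R\<^esub> \<one>\<^bsub>R\<^esub>) \<otimes>\<^bsub>R\<^esub> f \<in> ?J" using f by (intro lclosed) auto
      moreover have "f \<in> carrier R" using f I.Icarr by auto
      ultimately show "\<ominus>\<^bsub>R\<^esub> f \<in> ?J" by (simp add: R.l_minus)
    qed (use add I.Icarr in auto)
    show "f \<otimes>\<^bsub>R\<^esub> a \<in> ?J" if "f \<in> ?J" "a \<in> carrier R" for a f
      using lclosed[OF that(2,1)] that I.Icarr by (simp add: R.m_comm)
  qed (use lclosed R.ring_axioms in auto)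
  then have "?I \<subseteq> ?J"
    by (rule R.genideal_minimal) (use eq R.genideal_self[OF assms(2)] in auto)
  then show ?thesis
    using h k by (intro PiE_ext[of h ?I "\<lambda>_. carrier (R Quot ?I)" k]) (auto simp: Hom_quot_def)
qed

text \<open>A map \<open>T\<close> with values in \<open>R\<close> itself induces a homomorphism
  once it is additive and respects scalars up to errors in \<open>I\<close>. Derivations and the
  contraction of the comparable case both enter in this form.\<close>

lemma Hom_quot_cosetI:
  assumes "cring R" "ideal I R" "T \<in> I \<rightarrow> carrier R"
    and add: "\<And>f g. f \<in> I \<Longrightarrow> g \<in> I \<Longrightarrow> T (f \<oplus>\<^bsub>R\<^esub> g) = T f \<oplus>\<^bsub>R\<^esub> T g"
    and mult: "\<And>a f. a \<in> carrier R \<Longrightarrow> f \<in> I \<Longrightarrow> T (a \<otimes>\<^bsub>R\<^esub> f) \<ominus>\<^bsub>R\<^esub> a \<otimes>\<^bsub>R\<^esub> T f \<in> I"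
  shows "(\<lambda>f\<in>I. I +>\<^bsub>R\<^esub> T f) \<in> Hom_quot R I"
proof -
  interpret R: cring R by fact
  interpret I: ideal I R by fact
  interpret \<pi>: ring_hom_cring R "R Quot I" "(+>\<^bsub>R\<^esub>) I" by (rule I.rcos_ring_hom_cring) fact
  have T: "T f \<in> carrier R" if "f \<in> I" for f using assms(3) that by auto
  have I_mult: "a \<otimes>\<^bsub>R\<^esub> f \<in> I" if "f \<in> I" "a \<in> carrier R" for f a
    using that by (rule I.I_l_closed)
  have "I +>\<^bsub>R\<^esub> T (a \<otimes>\<^bsub>R\<^esub> f) = I +>\<^bsub>R\<^esub> (a \<otimes>\<^bsub>R\<^esub> T f)" if "a \<in> carrier R" "f \<in> I" for a f
    using mult[OF that] that T I_mult by (simp add: I.a_r_coset_eq_iff del: \<pi>.hom_mult)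
  then show ?thesis
    by (auto simp: Hom_quot_def T add I_mult)
qed

section \<open>Finitely supported maps\<close>

abbreviation "lookup \<equiv> Poly_Mapping.lookup"
abbreviation "keys \<equiv> Poly_Mapping.keys"
abbreviation "single \<equiv> Poly_Mapping.single"

lemma poly_mapping_sum_singles:
  fixes f :: "'a \<Rightarrow>\<^sub>0 'b::comm_monoid_add"
  shows "(\<Sum>m\<in>keys f. single m (lookup f m)) = f"
  by (rule poly_mapping_eqI) (auto simp: lookup_sum lookup_single when_def in_keys_iff)

text \<open>A finitely supported map is the finite sum of its terms. The set \<open>A\<close>
  carries a restriction on the exponents through the induction, such as divisibility by a
  generator.\<close>

lemma single_add_induct [consumes 1, case_names zero single add]:
  fixes f :: "'a \<Rightarrow>\<^sub>0 'b::comm_monoid_add"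
  assumes "keys f \<subseteq> A" "P 0" "\<And>m c. m \<in> A \<Longrightarrow> P (single m c)"
    "\<And>f g. P f \<Longrightarrow> P g \<Longrightarrow> P (f + g)"
  shows "P f"
proof -
  have "P (\<Sum>m\<in>B. single m (lookup f m))" if "finite B" "B \<subseteq> A" for B
    using that by (induction B) (auto intro: assms)
  from this[OF finite_keys assms(1)] show ?thesis by (simp add: poly_mapping_sum_singles)
qed

lemma lookup_single_mult:
  fixes f :: "'a::cancel_comm_monoid_add \<Rightarrow>\<^sub>0 'k::semiring_0"
  shows "lookup (single t c * f) (t + m) = c * lookup f m"
  by (simp add: lookup_mult lookup_single when_mult)

lemma lookup_single_mult_eq_0:
  fixes f :: "'a::cancel_comm_monoid_add \<Rightarrow>\<^sub>0 'k::semiring_0"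
  assumes "\<And>m. n \<noteq> t + m"
  shows "lookup (single t c * f) n = 0"
proof -
  have "n \<notin> keys (single t c * f)"
    using keys_mult[of "single t c" f] assms by (auto split: if_splits)
  then show ?thesis by (simp add: in_keys_iff)
qed

text \<open>Subtraction of exponents is truncated at zero; the hypothesis says that the monomial of
  \<open>b\<close> divides that of \<open>m\<close>, so that \<open>m - b\<close> is the exponent of
  the quotient.\<close>

lemma poly_mapping_add_diff:
  fixes m :: "'v \<Rightarrow>\<^sub>0 nat"
  assumes "\<And>v. lookup b v \<le> lookup m v"
  shows "b + (m - b) = m"
  by (rule poly_mapping_eqI) (use assms in \<open>simp add: lookup_add lookup_minus\<close>)

subsection \<open>Polynomial rings and monomial ideals\<close>

lemma carrier_poly_ring:
  "f \<in> carrier (poly_ring V) \<longleftrightarrow> (\<forall>m \<in> keys f. keys m \<subseteq> V)"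
  by (simp add: poly_ring_def)

lemma poly_ring_simps [simp]:
  "f \<otimes>\<^bsub>poly_ring V\<^esub> g = f * g" "f \<oplus>\<^bsub>poly_ring V\<^esub> g = f + g"
  "\<one>\<^bsub>poly_ring V\<^esub> = 1" "\<zero>\<^bsub>poly_ring V\<^esub> = 0"
  by (auto simp: poly_ring_def)

lemma poly_ring_uminus_closed: "f \<in> carrier (poly_ring V) \<Longrightarrow> - f \<in> carrier (poly_ring V)"
  by (auto simp: carrier_poly_ring in_keys_iff)

lemma poly_ring_closed:
  assumes "f \<in> carrier (poly_ring V)" "g \<in> carrier (poly_ring V)"
  shows "f + g \<in> carrier (poly_ring V)" "f * g \<in> carrier (poly_ring V)"
proof -
  show "f + g \<in> carrier (poly_ring V)"
    using assms keys_add[of f g] by (auto simp: carrier_poly_ring)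
  show "f * g \<in> carrier (poly_ring V)"
  proof (unfold carrier_poly_ring, intro ballI)
    fix m assume "m \<in> keys (f * g)"
    then obtain a b where "m = a + b" "a \<in> keys f" "b \<in> keys g" using keys_mult[of f g] by auto
    then show "keys m \<subseteq> V" using assms keys_add[of a b] unfolding carrier_poly_ring by blast
  qed
qed

lemma poly_ring_sum_closed:
  "(\<And>i. i \<in> A \<Longrightarrow> f i \<in> carrier (poly_ring V)) \<Longrightarrow> sum f A \<in> carrier (poly_ring V)"
proof (induction A rule: infinite_finite_induct)
  case (insert x A)
  then show ?case by (simp add: poly_ring_closed)
qed (auto simp: carrier_poly_ring)

lemma single_in_poly_ring: "keys m \<subseteq> V \<Longrightarrow> single m c \<in> carrier (poly_ring V)"
  by (cases "c = 0") (auto simp: carrier_poly_ring)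

lemma poly_ring_cring: "cring (poly_ring V)"
proof (rule cringI)
  show "abelian_group (poly_ring V)"
  proof (rule abelian_groupI)
    fix f assume "f \<in> carrier (poly_ring V)"
    then show "\<exists>g\<in>carrier (poly_ring V). g \<oplus>\<^bsub>poly_ring V\<^esub> f = \<zero>\<^bsub>poly_ring V\<^esub>"
      by (intro bexI[of _ "- f"]) (auto dest: poly_ring_uminus_closed)
  qed (auto simp: poly_ring_closed add_ac, simp add: carrier_poly_ring)
  show "comm_monoid (poly_ring V)"
    by (rule comm_monoidI) (auto simp: poly_ring_closed mult_ac, simp add: carrier_poly_ring)
qed (simp add: distrib_right)

lemma poly_ring_minus:
  assumes "f \<in> carrier (poly_ring V)" "g \<in> carrier (poly_ring V)"
  shows "f \<ominus>\<^bsub>poly_ring V\<^esub> g = f - g"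
proof -
  interpret cring "poly_ring V" by (rule poly_ring_cring)
  have "\<ominus>\<^bsub>poly_ring V\<^esub> g = - g"
    by (rule minus_equality) (use assms poly_ring_uminus_closed in \<open>auto\<close>)
  then show ?thesis by (simp add: a_minus_def)
qed

text \<open>Describing the ideal by supports turns membership into a condition on each exponent
  separately, so that congruences can be checked coefficient by coefficient outside
  \<open>M\<close>. It is an ideal once \<open>M\<close> is closed under adding exponents.\<close>

definition monomial_ideal :: "'v set \<Rightarrow> ('v \<Rightarrow>\<^sub>0 nat) set \<Rightarrow> ('v, 'k::field) mpoly set" where
  "monomial_ideal V M = {f \<in> carrier (poly_ring V). keys f \<subseteq> M}"

lemma keys_mult_subset:
  fixes f g :: "('v, 'k::field) mpoly"
  assumes "keys f \<subseteq> M" "\<And>m n. m \<in> M \<Longrightarrow> n + m \<in> M"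
  shows "keys (g * f) \<subseteq> M"
  using keys_mult[of g f] assms by blast

lemma ideal_monomial_ideal:
  fixes M :: "('v \<Rightarrow>\<^sub>0 nat) set"
  assumes "\<And>m n. m \<in> M \<Longrightarrow> n + m \<in> M"
  shows "ideal (monomial_ideal V M :: ('v, 'k::field) mpoly set) (poly_ring V)"
proof (rule idealI)
  interpret cring "poly_ring V :: ('v, 'k::field) mpoly ring" by (rule poly_ring_cring)
  show "ring (poly_ring V :: ('v, 'k) mpoly ring)" by (rule ring_axioms)
  show "subgroup (monomial_ideal V M) (add_monoid (poly_ring V :: ('v, 'k) mpoly ring))"
  proof (rule add.subgroupI)
    fix f :: "('v, 'k) mpoly" assume f: "f \<in> monomial_ideal V M"
    then have "\<ominus>\<^bsub>poly_ring V\<^esub> f = 0 - f"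
      using poly_ring_minus[of 0 V f] by (simp add: monomial_ideal_def a_minus_def carrier_poly_ring)
    then show "\<ominus>\<^bsub>poly_ring V\<^esub> f \<in> monomial_ideal V M"
      using f by (auto simp: monomial_ideal_def carrier_poly_ring in_keys_iff)
  next
    fix f g :: "('v, 'k) mpoly"
    assume "f \<in> monomial_ideal V M" "g \<in> monomial_ideal V M"
    then show "f \<oplus>\<^bsub>poly_ring V\<^esub> g \<in> monomial_ideal V M"
      using keys_add[of f g] by (auto simp: monomial_ideal_def poly_ring_closed)
  qed (auto simp: monomial_ideal_def carrier_poly_ring intro: exI[of _ 0])
next
  fix f g :: "('v, 'k) mpoly"
  assume f: "f \<in> monomial_ideal V M" and g: "g \<in> carrier (poly_ring V)"
  have "g * f \<in> carrier (poly_ring V)"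
    using f g unfolding monomial_ideal_def by (intro poly_ring_closed(2)) blast+
  moreover have "keys (g * f) \<subseteq> M"
    using f by (intro keys_mult_subset assms) (auto simp: monomial_ideal_def)
  ultimately show "g \<otimes>\<^bsub>poly_ring V\<^esub> f \<in> monomial_ideal V M" "f \<otimes>\<^bsub>poly_ring V\<^esub> g \<in> monomial_ideal V M"
    by (simp_all add: monomial_ideal_def mult.commute)
qed

subsection \<open>The ideal of isotone maps\<close>

text \<open>This is the exponent of \<open>isotone_monomial P \<phi>\<close>. With
  \<open>P - {p}\<close> in place of \<open>P\<close> it is the exponent left after removing the
  factor of row \<open>p\<close>, which is what partial derivatives produce.\<close>

definition graph_exponent :: "'p set \<Rightarrow> ('p \<Rightarrow> 'q) \<Rightarrow> ('p \<times> 'q \<Rightarrow>\<^sub>0 nat)" where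
  "graph_exponent P \<phi> = (\<Sum>p\<in>P. single (p, \<phi> p) 1)"

lemma lookup_graph_exponent:
  assumes "finite P"
  shows "lookup (graph_exponent P \<phi>) (p, q) = (if p \<in> P \<and> \<phi> p = q then 1 else 0)"
proof -
  have "lookup (graph_exponent P \<phi>) (p, q) = (\<Sum>x\<in>P. if x = p then (if \<phi> p = q then 1 else 0) else 0)"
    unfolding graph_exponent_def lookup_sum lookup_single when_def by (rule sum.cong) auto
  then show ?thesis unfolding sum.delta[OF assms] by simp
qed

lemma graph_exponent_remove:
  "finite P \<Longrightarrow> p \<in> P \<Longrightarrow> graph_exponent P \<phi> = single (p, \<phi> p) 1 + graph_exponent (P - {p}) \<phi>"
  by (simp add: graph_exponent_def sum.remove)

lemma isotone_monomial_eq: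
  "finite P \<Longrightarrow> isotone_monomial P \<phi> = single (graph_exponent P \<phi>) 1"
  unfolding isotone_monomial_def graph_exponent_def
  by (induction P rule: finite_induct) (auto simp: X_def mult_single)

lemma keys_graph_exponent: "finite P \<Longrightarrow> \<phi> ` P \<subseteq> Q \<Longrightarrow> keys (graph_exponent P \<phi>) \<subseteq> P \<times> Q"
  by (force simp: in_keys_iff lookup_graph_exponent split: if_splits)

text \<open>These are the exponents of multiples of generators: the generators are squarefree, so
  divisibility amounts to positivity along the graph of some \<open>\<phi>\<close>.\<close>

definition isotone_exponents :: "'p::order set \<Rightarrow> 'q::order set \<Rightarrow> ('p \<times> 'q \<Rightarrow>\<^sub>0 nat) set" where
  "isotone_exponents P Q = {m. \<exists>\<phi>\<in>isotone_maps P Q. \<forall>p\<in>P. 0 < lookup m (p, \<phi> p)}"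

lemma isotone_exponents_add: "m \<in> isotone_exponents P Q \<Longrightarrow> n + m \<in> isotone_exponents P Q"
  by (simp add: isotone_exponents_def lookup_add) (meson)

lemma graph_exponent_in_isotone_exponents:
  "finite P \<Longrightarrow> \<phi> \<in> isotone_maps P Q \<Longrightarrow> graph_exponent P \<phi> \<in> isotone_exponents P Q"
  by (auto simp: isotone_exponents_def lookup_graph_exponent)

lemma isotone_monomial_in_poly_ring:
  assumes "finite P" "\<phi> \<in> isotone_maps P Q"
  shows "isotone_monomial P \<phi> \<in> carrier (poly_ring (P \<times> Q))"
proof -
  have "\<phi> ` P \<subseteq> Q" using assms(2) by (auto simp: isotone_maps_def)
  then show ?thesis
    unfolding isotone_monomial_eq[OF assms(1)]
    by (intro single_in_poly_ring keys_graph_exponent assms(1))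
qed

lemma isotone_monomial_in_isotone_ideal:
  fixes P :: "'p::order set" and Q :: "'q::order set"
  assumes "finite P" "\<phi> \<in> isotone_maps P Q"
  shows "isotone_monomial P \<phi> \<in> (isotone_ideal P Q :: ('p \<times> 'q, 'k::field) mpoly set)"
proof -
  interpret cring "poly_ring (P \<times> Q) :: ('p \<times> 'q, 'k) mpoly ring" by (rule poly_ring_cring)
  show ?thesis
    unfolding isotone_ideal_def
    using genideal_self[of "isotone_monomial P ` isotone_maps P Q"]
      isotone_monomial_in_poly_ring[OF assms(1)] assms(2) by blast
qed

text \<open>The generators have their exponents in the given set, which is closed under multiples.
  Conversely, each term of a polynomial supported there is a generator times a term of the
  polynomial ring.\<close>

lemma isotone_ideal_eq:
  fixes P :: "'p::order set" and Q :: "'q::order set"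
  assumes "finite P"
  shows "isotone_ideal P Q = (monomial_ideal (P \<times> Q) (isotone_exponents P Q) :: ('p \<times> 'q, 'k::field) mpoly set)"
proof
  interpret cring "poly_ring (P \<times> Q) :: ('p \<times> 'q, 'k::field) mpoly ring" by (rule poly_ring_cring)
  let ?A = "isotone_monomial P ` isotone_maps P Q :: ('p \<times> 'q, 'k::field) mpoly set"
  let ?V = "P \<times> Q"
  have A: "?A \<subseteq> carrier (poly_ring ?V)" using isotone_monomial_in_poly_ring[OF assms] by blast
  interpret I: ideal "isotone_ideal P Q" "poly_ring ?V :: ('p \<times> 'q, 'k::field) mpoly ring"
    unfolding isotone_ideal_def by (rule genideal_ideal[OF A])
  have "?A \<subseteq> monomial_ideal ?V (isotone_exponents P Q)"
    using isotone_monomial_in_poly_ring[OF assms] graph_exponent_in_isotone_exponents[OF assms]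
    by (fastforce simp: monomial_ideal_def isotone_monomial_eq[OF assms])
  then show "isotone_ideal P Q \<subseteq> (monomial_ideal ?V (isotone_exponents P Q) :: ('p \<times> 'q, 'k) mpoly set)"
    unfolding isotone_ideal_def
    by (intro genideal_minimal ideal_monomial_ideal isotone_exponents_add)
  show "monomial_ideal ?V (isotone_exponents P Q) \<subseteq> (isotone_ideal P Q :: ('p \<times> 'q, 'k) mpoly set)"
  proof
    fix f :: "('p \<times> 'q, 'k) mpoly" assume "f \<in> monomial_ideal ?V (isotone_exponents P Q)"
    then have "keys f \<subseteq> {m \<in> isotone_exponents P Q. keys m \<subseteq> ?V}"
      by (auto simp: monomial_ideal_def carrier_poly_ring)
    then show "f \<in> isotone_ideal P Q"
    proof (induction rule: single_add_induct)
      case zero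
      show ?case using I.zero_closed by simp
    next
      case (single m c)
      then obtain \<phi> where \<phi>: "\<phi> \<in> isotone_maps P Q" "\<forall>p\<in>P. 0 < lookup m (p, \<phi> p)"
        by (auto simp: isotone_exponents_def)
      have "lookup (graph_exponent P \<phi>) v \<le> lookup m v" for v
        using \<phi>(2) by (cases v) (auto simp: lookup_graph_exponent[OF assms] Suc_le_eq)
      then have m: "graph_exponent P \<phi> + (m - graph_exponent P \<phi>) = m" by (rule poly_mapping_add_diff)
      have u: "isotone_monomial P \<phi> \<in> (isotone_ideal P Q :: ('p \<times> 'q, 'k) mpoly set)"
        by (rule isotone_monomial_in_isotone_ideal[OF assms \<phi>(1)])
      have "keys (m - graph_exponent P \<phi>) \<subseteq> keys m"
        by (auto simp: in_keys_iff lookup_minus)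
      then have "single (m - graph_exponent P \<phi>) c \<in> carrier (poly_ring ?V)"
        using single by (intro single_in_poly_ring) blast
      with u have "isotone_monomial P \<phi> \<otimes>\<^bsub>poly_ring ?V\<^esub> single (m - graph_exponent P \<phi>) c \<in> isotone_ideal P Q"
        by (rule I.I_r_closed)
      then show ?case by (simp add: isotone_monomial_eq[OF assms] mult_single m)
    next
      case (add f g)
      then show ?case using I.a_closed by fastforce
    qed
  qed
qed

subsection \<open>Partial derivatives and contractions\<close>

text \<open>Division by the monomial with exponent \<open>b\<close>, where terms that are not
  divisible are dropped: pulling back along the injection \<open>(+) b\<close> reads the coefficient
  of \<open>m\<close> off at \<open>b + m\<close>.\<close>

definition contract :: "('v \<Rightarrow>\<^sub>0 nat) \<Rightarrow> ('v, 'k::field) mpoly \<Rightarrow> ('v, 'k) mpoly" where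
  "contract b f = Poly_Mapping.map_key ((+) b) f"

lemma lookup_contract: "lookup (contract b f) m = lookup f (b + m)"
  by (simp add: contract_def map_key.rep_eq)

lemma contract_add: "contract b (f + g) = contract b f + contract b g"
  by (rule poly_mapping_eqI) (simp add: lookup_contract lookup_add)

lemma contract_single_add: "contract b (single (b + m) c) = single m c"
  by (rule poly_mapping_eqI) (simp add: lookup_contract lookup_single)

lemma contract_single_eq_0: "(\<And>k. m \<noteq> b + k) \<Longrightarrow> contract b (single m c) = 0"
  by (rule poly_mapping_eqI) (simp add: lookup_contract lookup_single when_def)

lemma contract_0 [simp]: "contract b 0 = 0"
  by (rule poly_mapping_eqI) (simp add: lookup_contract)

lemma contract_in_poly_ring:
  assumes "f \<in> carrier (poly_ring V)"
  shows "contract b f \<in> carrier (poly_ring V)"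
proof -
  have "keys m \<subseteq> keys (b + m)" "m \<in> keys (contract b f) \<Longrightarrow> b + m \<in> keys f" for m
    by (auto simp: in_keys_iff lookup_add lookup_contract)
  then show ?thesis using assms unfolding carrier_poly_ring by blast
qed

definition partial_deriv :: "'v \<Rightarrow> ('v, 'k::field) mpoly \<Rightarrow> ('v, 'k) mpoly" where
  "partial_deriv v f = contract (single v 1) (Poly_Mapping.mapp (\<lambda>m c. of_nat (lookup m v) * c) f)"

lemma lookup_partial_deriv:
  "lookup (partial_deriv v f) m = of_nat (Suc (lookup m v)) * lookup f (single v 1 + m)"
  by (auto simp: partial_deriv_def lookup_contract lookup_mapp lookup_add when_def in_keys_iff)

lemma partial_deriv_add: "partial_deriv v (f + g) = partial_deriv v f + partial_deriv v g"
  by (rule poly_mapping_eqI) (simp add: lookup_partial_deriv lookup_add distrib_left)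

lemma partial_deriv_0 [simp]: "partial_deriv v 0 = 0"
  by (rule poly_mapping_eqI) (simp add: lookup_partial_deriv)

lemma partial_deriv_single_add:
  "partial_deriv v (single (single v 1 + m) c) = single m (of_nat (Suc (lookup m v)) * c)"
  by (rule poly_mapping_eqI) (auto simp: lookup_partial_deriv lookup_single when_def)

lemma partial_deriv_single_eq_0:
  assumes "lookup m v = 0"
  shows "partial_deriv v (single m c) = 0"
proof (rule poly_mapping_eqI)
  fix n
  have "m \<noteq> single v 1 + n" using assms by (auto simp: lookup_add)
  then show "lookup (partial_deriv v (single m c)) n = lookup 0 n"
    by (simp add: lookup_partial_deriv lookup_single when_def)
qed

text \<open>A monomial either lacks \<open>v\<close> or is \<open>v\<close> times another monomial,
  and its derivative is explicit in both cases. When \<open>v\<close> occurs in both factors, the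
  rule expresses that the exponents of \<open>v\<close> add up.\<close>

lemma partial_deriv_mult_single:
  "partial_deriv v (single m c * single n d) =
    single m c * partial_deriv v (single n d) + single n d * partial_deriv v (single m c)"
proof -
  have split: "lookup k v = 0 \<or> (\<exists>j. k = single v 1 + j)" for k :: "'a \<Rightarrow>\<^sub>0 nat"
  proof (cases "lookup k v = 0")
    case False
    then have "single v 1 + (k - single v 1) = k"
      by (intro poly_mapping_add_diff) (auto simp: lookup_single when_def Suc_le_eq)
    then show ?thesis by metis
  qed simp
  consider "lookup m v = 0" "lookup n v = 0" | j where "m = single v 1 + j" "lookup n v = 0"
    | k where "lookup m v = 0" "n = single v 1 + k" | j k where "m = single v 1 + j" "n = single v 1 + k"
    using split[of m] split[of n] by metis
  then show ?thesis
  proof cases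
    case 1
    then show ?thesis by (simp add: mult_single partial_deriv_single_eq_0 lookup_add)
  next
    case (2 j)
    have D: "partial_deriv v (single m c) = single j (of_nat (Suc (lookup j v)) * c)"
      by (simp only: 2 partial_deriv_single_add)
    have "partial_deriv v (single m c * single n d) = single (j + n) (of_nat (Suc (lookup (j + n) v)) * (c * d))"
      by (simp only: mult_single 2 add.assoc partial_deriv_single_add)
    then show ?thesis
      unfolding D partial_deriv_single_eq_0[OF 2(2)] by (simp add: mult_single 2 lookup_add ac_simps)
  next
    case (3 k)
    have D: "partial_deriv v (single n d) = single k (of_nat (Suc (lookup k v)) * d)"
      by (simp only: 3 partial_deriv_single_add)
    have "partial_deriv v (single m c * single n d) = single (m + k) (of_nat (Suc (lookup (m + k) v)) * (c * d))"
      by (simp only: mult_single 3 add.left_commute[of m] partial_deriv_single_add)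
    then show ?thesis
      unfolding D partial_deriv_single_eq_0[OF 3(1)] by (simp add: mult_single 3 lookup_add ac_simps)
  next
    case (4 j k)
    let ?n = "single v 1 + (j + k)"
    have D: "partial_deriv v (single m c) = single j (of_nat (Suc (lookup j v)) * c)"
      "partial_deriv v (single n d) = single k (of_nat (Suc (lookup k v)) * d)"
      by (simp_all only: 4 partial_deriv_single_add)
    have "single m c * single n d = single (single v 1 + ?n) (c * d)"
      by (simp only: mult_single 4 ac_simps)
    then have "partial_deriv v (single m c * single n d) = single ?n (of_nat (Suc (lookup ?n v)) * (c * d))"
      by (simp only: partial_deriv_single_add)
    moreover have "single m c * partial_deriv v (single n d) = single ?n (of_nat (Suc (lookup k v)) * (c * d))"
      "single n d * partial_deriv v (single m c) = single ?n (of_nat (Suc (lookup j v)) * (c * d))"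
      unfolding D unfolding mult_single 4 by (simp_all only: ac_simps)
    ultimately show ?thesis
      by (simp only: single_add[symmetric] distrib_right[symmetric] of_nat_add[symmetric])
        (simp add: lookup_add add_ac)
  qed
qed

lemma partial_deriv_mult:
  "partial_deriv v (f * g) = f * partial_deriv v g + g * partial_deriv v f"
proof (rule single_add_induct[of f UNIV])
  fix m c
  show "partial_deriv v (single m c * g) = single m c * partial_deriv v g + g * partial_deriv v (single m c)"
    by (rule single_add_induct[of g UNIV])
      (auto simp: partial_deriv_mult_single partial_deriv_add algebra_simps)
qed (auto simp: partial_deriv_add algebra_simps)

lemma partial_deriv_Cst: "partial_deriv v (Cst c) = 0"
  by (simp add: Cst_def partial_deriv_single_eq_0)

lemma partial_deriv_in_poly_ring:
  assumes "f \<in> carrier (poly_ring V)"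
  shows "partial_deriv v f \<in> carrier (poly_ring V)"
proof -
  have "keys m \<subseteq> keys (single v 1 + m)" "m \<in> keys (partial_deriv v f) \<Longrightarrow> single v 1 + m \<in> keys f" for m
    by (auto simp: in_keys_iff lookup_add lookup_partial_deriv)
  then show ?thesis using assms unfolding carrier_poly_ring by blast
qed

section \<open>Derivations and the criterion for rigidity\<close>

lemma sum_partial_deriv_in_derivations:
  assumes "d ` V \<subseteq> carrier (poly_ring V)"
  shows "(\<lambda>f\<in>carrier (poly_ring V). \<Sum>v\<in>V. d v * partial_deriv v f) \<in> derivations V"
proof -
  have "Cst c \<in> carrier (poly_ring V)" for c :: 'b
    unfolding Cst_def by (rule single_in_poly_ring) simp
  moreover have "(\<Sum>v\<in>V. d v * partial_deriv v f) \<in> carrier (poly_ring V)"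
    if "f \<in> carrier (poly_ring V)" for f
    using that assms by (intro poly_ring_sum_closed poly_ring_closed partial_deriv_in_poly_ring) auto
  moreover have "(\<Sum>v\<in>V. d v * partial_deriv v (f + g)) =
      (\<Sum>v\<in>V. d v * partial_deriv v f) + (\<Sum>v\<in>V. d v * partial_deriv v g)" for f g
    by (simp add: partial_deriv_add distrib_left sum.distrib)
  moreover have "(\<Sum>v\<in>V. d v * partial_deriv v (f * g)) =
      f * (\<Sum>v\<in>V. d v * partial_deriv v g) + g * (\<Sum>v\<in>V. d v * partial_deriv v f)" for f g
    by (simp add: partial_deriv_mult distrib_left sum.distrib sum_distrib_left mult.left_commute)
  moreover have "(\<Sum>v\<in>V. d v * partial_deriv v (Cst c * f)) =
      Cst c * (\<Sum>v\<in>V. d v * partial_deriv v f)" for c f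
    by (simp add: partial_deriv_mult partial_deriv_Cst sum_distrib_left mult.left_commute)
  ultimately show ?thesis
    unfolding derivations_def Let_def by (simp add: poly_ring_closed)
qed

text \<open>A derivation fails to be linear by \<open>D (a * f) - a * D f = f * D a\<close>, which
  lies in \<open>I\<close> whenever \<open>f\<close> does.\<close>

lemma delta_star_in_Hom_quot:
  assumes I: "ideal I (poly_ring V :: ('v, 'k::field) mpoly ring)" and D: "D \<in> derivations V"
  shows "delta_star V I D \<in> Hom_quot (poly_ring V) I"
proof -
  let ?R = "poly_ring V :: ('v, 'k::field) mpoly ring"
  have IR: "f \<in> carrier ?R" if "f \<in> I" for f using that by (rule ideal.Icarr[OF I])
  have DR: "D f \<in> carrier ?R" if "f \<in> carrier ?R" for f
    using D that by (auto simp: derivations_def Let_def)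
  show "delta_star V I D \<in> Hom_quot ?R I"
    unfolding delta_star_def
  proof (rule Hom_quot_cosetI[OF poly_ring_cring I])
    fix a f assume a: "a \<in> carrier ?R" and f: "f \<in> I"
    have "D (a * f) = a * D f + f * D a"
      using D a IR[OF f] by (simp add: derivations_def Let_def)
    then have "D (a \<otimes>\<^bsub>?R\<^esub> f) \<ominus>\<^bsub>?R\<^esub> a \<otimes>\<^bsub>?R\<^esub> D f = f \<otimes>\<^bsub>?R\<^esub> D a"
      using a IR[OF f] by (simp add: poly_ring_minus poly_ring_closed DR)
    then show "D (a \<otimes>\<^bsub>?R\<^esub> f) \<ominus>\<^bsub>?R\<^esub> a \<otimes>\<^bsub>?R\<^esub> D f \<in> I"
      using ideal.I_r_closed[OF I f DR[OF a]] by simp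
  next
    fix f g assume "f \<in> I" "g \<in> I"
    then show "D (f \<oplus>\<^bsub>?R\<^esub> g) = D f \<oplus>\<^bsub>?R\<^esub> D g"
      using D IR by (simp add: derivations_def Let_def)
  qed (rule Pi_I, rule DR, rule IR)
qed

text \<open>The cokernel vanishes exactly when \<open>delta_star\<close> is surjective. The zero
  derivation puts the neutral element into the image, as \<open>trivial_group_Mod_iff\<close>
  demands.\<close>

lemma rigid_iff:
  assumes I: "ideal I (poly_ring V :: ('v, 'k::field) mpoly ring)"
  shows "rigid V I \<longleftrightarrow> Hom_quot (poly_ring V) I \<subseteq> delta_star V I ` derivations V"
proof -
  let ?R = "poly_ring V :: ('v, 'k::field) mpoly ring"
  let ?G = "Hom_quot_group ?R I"
  interpret G: comm_group ?G by (rule Hom_quot_comm_group[OF poly_ring_cring I])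
  have carrier_G: "carrier ?G = Hom_quot ?R I" by (simp add: Hom_quot_group_def)
  have IR: "f \<in> carrier ?R" if "f \<in> I" for f using that by (rule ideal.Icarr[OF I])
  have "delta_star V I ` derivations V \<subseteq> Hom_quot ?R I"
    using delta_star_in_Hom_quot[OF I] by blast
  moreover have "\<one>\<^bsub>?G\<^esub> \<in> delta_star V I ` derivations V"
  proof
    show "(\<lambda>f\<in>carrier ?R. \<Sum>v\<in>V. 0 * partial_deriv v f) \<in> derivations V"
      by (rule sum_partial_deriv_in_derivations) (auto simp: carrier_poly_ring)
    show "\<one>\<^bsub>?G\<^esub> = delta_star V I (\<lambda>f\<in>carrier ?R. \<Sum>v\<in>V. 0 * partial_deriv v f)"
      using ring.a_rcos_zero[OF cring.axioms(1)[OF poly_ring_cring] I, of 0]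
        additive_subgroup.zero_closed[OF ideal.axioms(1)[OF I]] IR
      by (auto simp: Hom_quot_group_def delta_star_def FactRing_def intro!: restrict_ext)
  qed
  ultimately show ?thesis
    unfolding rigid_def T1_def by (subst G.trivial_group_Mod_iff) (auto simp: carrier_G)
qed

lemma ideal_isotone_ideal:
  "finite P \<Longrightarrow> ideal (isotone_ideal P Q :: ('p::order \<times> 'q::order, 'k::field) mpoly set) (poly_ring (P \<times> Q))"
  unfolding isotone_ideal_eq by (rule ideal_monomial_ideal) (rule isotone_exponents_add)

lemma mem_isotone_ideal_iff:
  fixes f :: "('p::order \<times> 'q::order, 'k::field) mpoly"
  assumes "finite P"
  shows "f \<in> isotone_ideal P Q \<longleftrightarrow> f \<in> carrier (poly_ring (P \<times> Q)) \<and> keys f \<subseteq> isotone_exponents P Q"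
  by (simp add: isotone_ideal_eq[OF assms] monomial_ideal_def)

subsection \<open>Comparable elements\<close>

text \<open>By additivity it suffices to treat terms. If \<open>b\<close> divides \<open>m\<close>,
  the two expressions agree; if \<open>b\<close> does not even divide \<open>t + m\<close>, both
  vanish; if it divides \<open>t + m\<close> but not \<open>m\<close>, a single term at
  \<open>w + k\<close> remains, and the second hypothesis covers it.\<close>

lemma keys_contract_mult:
  fixes f g :: "('v, 'k::field) mpoly"
  assumes f: "keys f \<subseteq> M"
    and M: "\<And>m t k. m \<in> M \<Longrightarrow> t + m = b + k \<Longrightarrow> (\<And>j. m \<noteq> b + j) \<Longrightarrow> w + k \<in> M"
  shows "keys (single w 1 * contract b (g * f) - g * (single w 1 * contract b f)) \<subseteq> M"
    (is "keys (?E g f) \<subseteq> M")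
proof (rule single_add_induct[of g UNIV])
  have keys_plus: "keys x \<subseteq> M \<Longrightarrow> keys y \<subseteq> M \<Longrightarrow> keys (x + y) \<subseteq> M" for x y :: "('v, 'k::field) mpoly"
    using keys_add[of x y] by blast
  show "keys (?E (g1 + g2) f) \<subseteq> M" if "keys (?E g1 f) \<subseteq> M" "keys (?E g2 f) \<subseteq> M" for g1 g2
  proof -
    have "?E (g1 + g2) f = ?E g1 f + ?E g2 f"
      by (simp add: contract_add distrib_left distrib_right)
    then show ?thesis using keys_plus[OF that] by simp
  qed
  show "keys (?E (single t c) f) \<subseteq> M" for t c
    using f
  proof (induction rule: single_add_induct)
    case (single m e)
    consider j where "m = b + j" | k where "\<And>j. m \<noteq> b + j" "t + m = b + k"
      | "\<And>j. m \<noteq> b + j" "\<And>k. t + m \<noteq> b + k" by blast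
    then show ?case
    proof cases
      case (1 j)
      have "t + m = b + (t + j)" "t + (w + j) = w + (t + j)" by (simp_all only: 1 ac_simps)
      then have "?E (single t c) (single m e) = 0"
        by (simp only: mult_single contract_single_add 1) simp
      then show ?thesis by simp
    next
      case (2 k)
      then have "contract b (single m e) = 0" by (intro contract_single_eq_0)
      then have "?E (single t c) (single m e) = single (w + k) (c * e)"
        by (simp add: mult_single 2(2) contract_single_add)
      then show ?thesis using M[OF single 2(2,1)] by simp
    next
      case 3
      then show ?thesis by (simp add: mult_single contract_single_eq_0)
    qed
  next
    case (add x y)
    have "?E (single t c) (x + y) = ?E (single t c) x + ?E (single t c) y"
      by (simp add: contract_add distrib_left)
    then show ?case using keys_plus[OF add] by simp
  qed simp
qed auto

lemma not_rigid_if_comparable: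
  fixes P :: "'p::order set" and Q :: "'q::order set"
  assumes fin: "finite P" "finite Q" and Q: "Q \<noteq> {}" and p: "p \<in> P" "p' \<in> P" "p < p'"
  shows "\<not> rigid (P \<times> Q) (isotone_ideal P Q :: ('p \<times> 'q, 'k::field) mpoly set)"
proof
  let ?V = "P \<times> Q" and ?M = "isotone_exponents P Q"
  let ?R = "poly_ring ?V :: ('p \<times> 'q, 'k::field) mpoly ring"
  let ?I = "isotone_ideal P Q :: ('p \<times> 'q, 'k::field) mpoly set"
  have I: "ideal ?I ?R" by (rule ideal_isotone_ideal) fact
  \<comment> \<open>Minimality ensures that an isotone map with value \<open>a\<close> at
    \<open>p'\<close> also takes the value \<open>a\<close> at \<open>p\<close>.\<close>
  obtain a where a: "a \<in> Q" and a_min: "\<And>c. c \<in> Q \<Longrightarrow> c \<le> a \<Longrightarrow> c = a"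
    using finite_has_minimal[OF fin(2) Q] by metis
  define b where "b = single (p, a) 1 + single (p', a) (1::nat)"
  \<comment> \<open>Outside row \<open>p'\<close>, \<open>W\<close> contains every column other than
    \<open>a\<close>, so for such a column \<open>w\<close> lacks just one variable of the monomial
    of the constant map. Leaving out row \<open>p'\<close> and \<open>(p, a)\<close> keeps these
    variables out of \<open>w + n\<close> below.\<close>
  define W where "W = {(r, c) \<in> ?V. r \<noteq> p' \<and> (r, c) \<noteq> (p, a)}"
  define w where "w = (\<Sum>v\<in>W. single v (1::nat))"
  have "finite W" using fin unfolding W_def by (intro finite_subset[OF _ finite_cartesian_product]) auto
  then have lookup_w: "lookup w v = (if v \<in> W then 1 else 0)" for v
    by (simp add: w_def lookup_sum lookup_single when_def)
  define T :: "('p \<times> 'q, 'k) mpoly \<Rightarrow> ('p \<times> 'q, 'k) mpoly" where "T f = single w 1 * contract b f" for f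
  define h where "h = (\<lambda>f\<in>?I. ?I +>\<^bsub>?R\<^esub> T f)"
  have w_R: "single w 1 \<in> carrier ?R"
    by (rule single_in_poly_ring) (auto simp: in_keys_iff lookup_w W_def split: if_splits)
  have T_R: "T f \<in> carrier ?R" if "f \<in> carrier ?R" for f
    unfolding T_def using that w_R by (intro poly_ring_closed contract_in_poly_ring)
  have T_I: "T f \<in> carrier ?R" if "f \<in> ?I" for f
    using T_R[OF ideal.Icarr[OF I that]] .
  have T_add: "T (f + g) = T f + T g" for f g by (simp add: T_def contract_add distrib_left)
  have const: "(\<lambda>x\<in>P. c) \<in> isotone_maps P Q" if "c \<in> Q" for c
    using that by (auto simp: isotone_maps_def mono_on_def)
  have shift: "w + k \<in> ?M" if m: "m \<in> ?M" and eq: "t + m = b + k" and no: "\<And>j. m \<noteq> b + j" for t m k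
  proof -
    obtain \<psi> where \<psi>: "\<psi> \<in> isotone_maps P Q" "\<forall>r\<in>P. 0 < lookup m (r, \<psi> r)"
      using m by (auto simp: isotone_exponents_def)
    have c: "\<psi> p' \<in> Q" "\<psi> p \<in> Q" "\<psi> p \<le> \<psi> p'"
      using \<psi>(1) p by (auto simp: isotone_maps_def mono_on_def)
    \<comment> \<open>Otherwise \<open>\<psi> p = a\<close> as well, and \<open>b\<close> divides
      \<open>m\<close>, contrary to \<open>no\<close>.\<close>
    have "\<psi> p' \<noteq> a"
    proof
      assume a': "\<psi> p' = a"
      then have "\<psi> p = a" using a_min c by metis
      then have "lookup b v \<le> lookup m v" for v
        using \<psi>(2) p a' by (auto simp: b_def lookup_add lookup_single when_def Suc_le_eq)
      then show False using no poly_mapping_add_diff[of b m] by metis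
    qed
    \<comment> \<open>In row \<open>p'\<close> the exponent \<open>b\<close> involves column
      \<open>a\<close> only, so the variable \<open>(p', \<psi> p')\<close> has to come from
      \<open>k\<close>; \<open>w\<close> supplies the same column in all other rows.\<close>
    moreover have "0 < lookup (b + k) (p', \<psi> p')"
      unfolding eq[symmetric] using \<psi>(2) p by (simp add: lookup_add)
    ultimately have "0 < lookup k (p', \<psi> p')"
      using p by (auto simp: b_def lookup_add lookup_single when_def)
    then have "\<forall>r\<in>P. 0 < lookup (w + k) (r, \<psi> p')"
      using c \<open>\<psi> p' \<noteq> a\<close> by (auto simp: lookup_add lookup_w W_def)
    then show ?thesis
      using const[OF c(1)] unfolding isotone_exponents_def
      by (intro CollectI bexI[of _ "\<lambda>x\<in>P. \<psi> p'"]) auto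
  qed
  have h: "h \<in> Hom_quot ?R ?I"
    unfolding h_def
  proof (rule Hom_quot_cosetI[OF poly_ring_cring I])
    fix g f assume g: "g \<in> carrier ?R" and f: "f \<in> ?I"
    have fR: "f \<in> carrier ?R" using f by (rule ideal.Icarr[OF I])
    have "T (g * f) - g * T f \<in> ?I"
    proof -
      have "keys f \<subseteq> ?M" using f mem_isotone_ideal_iff[OF fin(1)] by blast
      then have "keys (T (g * f) - g * T f) \<subseteq> ?M"
        unfolding T_def by (rule keys_contract_mult[OF _ shift])
      moreover have "T (g * f) + - (g * T f) \<in> carrier ?R"
        using g fR by (intro poly_ring_closed poly_ring_uminus_closed T_R)
      ultimately show ?thesis using mem_isotone_ideal_iff[OF fin(1)] by (metis diff_conv_add_uminus)
    qed
    then show "T (g \<otimes>\<^bsub>?R\<^esub> f) \<ominus>\<^bsub>?R\<^esub> g \<otimes>\<^bsub>?R\<^esub> T f \<in> ?I"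
      using g fR by (simp add: poly_ring_minus poly_ring_closed T_R)
  qed (auto simp: T_I T_add)
  let ?u = "isotone_monomial P (\<lambda>x\<in>P. a) :: ('p \<times> 'q, 'k) mpoly"
  define n where "n = graph_exponent (P - {p} - {p'}) (\<lambda>x\<in>P. a)"
  define g :: "('p \<times> 'q, 'k) mpoly" where "g = single n 1"
  have u_exp: "graph_exponent P (\<lambda>x\<in>P. a) = b + n"
    using p graph_exponent_remove[OF fin(1) p(1), of "\<lambda>x\<in>P. a"]
      graph_exponent_remove[of "P - {p}" p' "\<lambda>x\<in>P. a"] fin(1)
    by (simp add: b_def n_def add.assoc)
  have u: "?u = X (p, a) * (X (p', a) * g)"
    by (simp add: isotone_monomial_eq[OF fin(1)] u_exp X_def g_def mult_single b_def add.assoc)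
  have u_I: "?u \<in> ?I" by (rule isotone_monomial_in_isotone_ideal[OF fin(1) const[OF a]])
  have lookup_n: "lookup n (r, c) = (if r \<in> P - {p} - {p'} \<and> a = c then 1 else 0)" for r c
    unfolding n_def using fin(1) by (subst lookup_graph_exponent) auto
  have Tu: "T ?u = single (w + n) 1"
    by (simp add: isotone_monomial_eq[OF fin(1)] u_exp T_def contract_single_add mult_single)
  \<comment> \<open>Row \<open>p'\<close> is missing altogether from \<open>w + n\<close>, so no
    generator divides this monomial.\<close>
  have "w + n \<notin> ?M"
    using p by (auto simp: isotone_exponents_def lookup_add lookup_w W_def lookup_n)
  assume "rigid ?V ?I"
  then obtain D where D: "D \<in> derivations ?V" "h = delta_star ?V ?I D"
    using h rigid_iff[OF I] by blast
  have uR: "?u \<in> carrier ?R" using u_I by (rule ideal.Icarr[OF I])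
  have DR: "D f \<in> carrier ?R" if "f \<in> carrier ?R" for f
    using D(1) that by (auto simp: derivations_def Let_def)
  have "?I +>\<^bsub>?R\<^esub> T ?u = ?I +>\<^bsub>?R\<^esub> D ?u"
    using u_I fun_cong[OF D(2), of ?u] by (simp add: h_def delta_star_def)
  then have "T ?u - D ?u \<in> ?I"
    using uR by (simp add: ideal.a_r_coset_eq_iff[OF I] T_R DR poly_ring_minus)
  \<comment> \<open>As \<open>w + n\<close> is not an exponent of the ideal, congruent polynomials
    have the same coefficient there.\<close>
  then have "w + n \<notin> keys (T ?u - D ?u)"
    using \<open>w + n \<notin> ?M\<close> mem_isotone_ideal_iff[OF fin(1)] by blast
  then have "lookup (T ?u - D ?u) (w + n) = 0" by (simp add: in_keys_iff)
  then have "lookup (D ?u) (w + n) = 1" by (simp add: lookup_minus Tu)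
  moreover have "lookup (D ?u) (w + n) = 0"
  proof -
    have D_mult: "D (x * y) = x * D y + y * D x" if "x \<in> carrier ?R" "y \<in> carrier ?R" for x y
      using D(1) that by (simp add: derivations_def Let_def)
    have X_R: "X (p, a) \<in> carrier ?R" "X (p', a) \<in> carrier ?R"
      unfolding X_def using p a by (auto intro: single_in_poly_ring)
    have "g \<in> carrier ?R"
      unfolding g_def using a by (intro single_in_poly_ring) (auto simp: in_keys_iff lookup_n split: if_splits)
    \<comment> \<open>Whatever the values of \<open>D\<close>, the product rule leaves a multiple of
      \<open>X (p, a)\<close> plus a multiple of \<open>X (p', a)\<close>, and neither variable
      occurs in \<open>w + n\<close>.\<close>
    then have "D ?u = X (p, a) * D (X (p', a) * g) + X (p', a) * (g * D (X (p, a)))"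
      using X_R unfolding u by (simp add: D_mult poly_ring_closed mult.assoc)
    moreover have "lookup (X v * f) (w + n) = 0" if "lookup (w + n) v = 0" for v and f :: "('p \<times> 'q, 'k) mpoly"
      unfolding X_def
    proof (rule lookup_single_mult_eq_0)
      show "w + n \<noteq> single v 1 + m" for m
      proof
        assume "w + n = single v 1 + m"
        then have "lookup (w + n) v = lookup (single v 1 + m) v" by (rule arg_cong)
        then show False using that by (simp add: lookup_add)
      qed
    qed
    ultimately show ?thesis using p
      by (simp add: lookup_add lookup_w W_def lookup_n)
  qed
  ultimately show False by simp
qed

subsection \<open>Antichains\<close>

lemma antichain_isotone_maps:
  assumes "\<forall>p\<in>P. \<forall>p'\<in>P. p \<noteq> p' \<longrightarrow> \<not> (p \<le> p' \<or> p' \<le> p)"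
  shows "isotone_maps P Q = P \<rightarrow>\<^sub>E Q"
  using assms by (auto simp: isotone_maps_def mono_on_def)

text \<open>Values can be chosen independently in each row. In terms of ideals this is the
  decomposition into the intersection of the primes of the rows.\<close>

lemma antichain_isotone_exponents:
  assumes "\<forall>p\<in>P. \<forall>p'\<in>P. p \<noteq> p' \<longrightarrow> \<not> (p \<le> p' \<or> p' \<le> p)"
  shows "isotone_exponents P Q = {m. \<forall>p\<in>P. \<exists>q\<in>Q. 0 < lookup m (p, q)}"
proof -
  have "\<exists>\<phi>\<in>P \<rightarrow>\<^sub>E Q. \<forall>p\<in>P. 0 < lookup m (p, \<phi> p)" if m: "\<forall>p\<in>P. \<exists>q\<in>Q. 0 < lookup m (p, q)" for m
  proof -
    obtain \<phi> where "\<forall>p\<in>P. \<phi> p \<in> Q \<and> 0 < lookup m (p, \<phi> p)"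
      using bchoice[OF m[unfolded Bex_def]] by blast
    then show ?thesis by (intro bexI[of _ "restrict \<phi> P"]) auto
  qed
  then show ?thesis
    unfolding isotone_exponents_def antichain_isotone_maps[OF assms] by fastforce
qed

lemma partial_deriv_isotone_monomial:
  assumes "finite P" "p \<in> P"
  shows "partial_deriv (p, q) (isotone_monomial P \<phi>) =
    (if q = \<phi> p then single (graph_exponent (P - {p}) \<phi>) 1 else 0)"
proof (cases "q = \<phi> p")
  case True
  have "lookup (graph_exponent (P - {p}) \<phi>) (p, q) = 0"
    using assms by (subst lookup_graph_exponent) auto
  then show ?thesis
    by (simp only: isotone_monomial_eq[OF assms(1)] graph_exponent_remove[OF assms] True
        partial_deriv_single_add) simp
next
  case False
  then show ?thesis
    by (simp add: isotone_monomial_eq[OF assms(1)] partial_deriv_single_eq_0 lookup_graph_exponent[OF assms(1)])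
qed

text \<open>
  A monomial outside the ideal avoids all variables of some row \<open>p\<^sub>0\<close>. At such a monomial only the
  partial derivative in direction \<open>(p\<^sub>0, \<phi> p\<^sub>0)\<close> contributes.
\<close>
lemma lookup_sum_partial_deriv_isotone_monomial:
  fixes d :: "'p \<times> 'q \<Rightarrow> ('p \<times> 'q, 'k::field) mpoly"
  assumes fin: "finite P" "finite Q" and p0: "p0 \<in> P" and \<phi>: "\<phi> ` P \<subseteq> Q"
    and n: "\<And>q. q \<in> Q \<Longrightarrow> lookup n (p0, q) = 0"
  shows "lookup (\<Sum>v\<in>P \<times> Q. d v * partial_deriv v (isotone_monomial P \<phi>)) n =
    lookup (single (graph_exponent (P - {p0}) \<phi>) 1 * d (p0, \<phi> p0)) n"
proof -
  let ?v = "(p0, \<phi> p0)" and ?f = "\<lambda>v. d v * partial_deriv v (isotone_monomial P \<phi>)"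
  have "lookup (?f v) n = 0" if v: "v \<in> P \<times> Q - {?v}" for v
  proof -
    obtain p q where pq: "v = (p, q)" "p \<in> P" "q \<in> Q" using v by auto
    show ?thesis
    proof (cases "q = \<phi> p")
      case True
      then have "p \<noteq> p0" using v pq by auto
      \<comment> \<open>The derivative in another row keeps the variable
        \<open>(p0, \<phi> p0)\<close> as a factor, and this variable is absent from
        \<open>n\<close>.\<close>
      then have "lookup (graph_exponent (P - {p}) \<phi>) ?v = 1"
        using fin p0 by (subst lookup_graph_exponent) auto
      then have "n \<noteq> graph_exponent (P - {p}) \<phi> + m" for m
        using n[of "\<phi> p0"] \<phi> p0 by (auto simp: lookup_add)
      then show ?thesis
        using True pq by (simp add: partial_deriv_isotone_monomial fin mult.commute[of "d _"] lookup_single_mult_eq_0)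
    next
      case False
      then show ?thesis using pq by (simp add: partial_deriv_isotone_monomial fin)
    qed
  qed
  then have "(\<Sum>v\<in>P \<times> Q. lookup (?f v) n) = lookup (?f ?v) n"
    using fin p0 \<phi> by (subst sum.remove[of _ ?v]) (auto intro!: sum.neutral)
  then show ?thesis
    using p0 by (simp add: lookup_sum partial_deriv_isotone_monomial fin mult.commute[of "d _"])
qed

lemma Hom_quot_representative:
  assumes "h \<in> Hom_quot R I" "f \<in> I"
  obtains g where "g \<in> carrier R" "h f = I +>\<^bsub>R\<^esub> g"
proof -
  have "h f \<in> a_rcosets\<^bsub>R\<^esub> I" using assms by (auto simp: Hom_quot_def FactRing_def)
  then show ?thesis using that by (auto simp: A_RCOSETS_def' a_r_coset_def)
qed

text \<open>An exponent outside \<open>?M\<close> misses all variables of some row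
  \<open>p0\<close>; comparing coefficients at such exponents is what reduction modulo the prime of
  row \<open>p0\<close> amounts to.\<close>

lemma rigid_if_antichain:
  fixes P :: "'p::order set" and Q :: "'q::order set"
  assumes fin: "finite P" "finite Q" and Q: "2 \<le> card Q"
    and anti: "\<forall>p\<in>P. \<forall>p'\<in>P. p \<noteq> p' \<longrightarrow> \<not> (p \<le> p' \<or> p' \<le> p)"
  shows "rigid (P \<times> Q) (isotone_ideal P Q :: ('p \<times> 'q, 'k::field) mpoly set)"
proof -
  let ?V = "P \<times> Q" and ?M = "isotone_exponents P Q"
  let ?R = "poly_ring ?V :: ('p \<times> 'q, 'k::field) mpoly ring"
  let ?I = "isotone_ideal P Q :: ('p \<times> 'q, 'k::field) mpoly set"
  let ?u = "isotone_monomial P :: ('p \<Rightarrow> 'q) \<Rightarrow> ('p \<times> 'q, 'k::field) mpoly"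
  have I: "ideal ?I ?R" by (rule ideal_isotone_ideal) fact
  note maps = antichain_isotone_maps[OF anti, of Q]
  have M: "m \<in> ?M \<longleftrightarrow> (\<forall>p\<in>P. \<exists>q\<in>Q. 0 < lookup m (p, q))" for m
    using antichain_isotone_exponents[OF anti, of Q] by simp
  have uR: "?u \<phi> \<in> carrier ?R" and uI: "?u \<phi> \<in> ?I" if "\<phi> \<in> P \<rightarrow>\<^sub>E Q" for \<phi>
    using isotone_monomial_in_poly_ring[OF fin(1)] isotone_monomial_in_isotone_ideal[OF fin(1)]
      that[folded maps] by blast+
  have "h \<in> delta_star ?V ?I ` derivations ?V" if h: "h \<in> Hom_quot ?R ?I" for h
  proof -
    have "\<exists>g. \<forall>\<phi>\<in>P \<rightarrow>\<^sub>E Q. g \<phi> \<in> carrier ?R \<and> h (?u \<phi>) = ?I +>\<^bsub>?R\<^esub> g \<phi>"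
      using Hom_quot_representative[OF h uI] by (intro bchoice) metis
    then obtain g where gR: "\<And>\<phi>. \<phi> \<in> P \<rightarrow>\<^sub>E Q \<Longrightarrow> g \<phi> \<in> carrier ?R"
      and hg: "\<And>\<phi>. \<phi> \<in> P \<rightarrow>\<^sub>E Q \<Longrightarrow> h (?u \<phi>) = ?I +>\<^bsub>?R\<^esub> g \<phi>" by blast
    have XR: "X (p, q) \<in> carrier ?R" if "p \<in> P" "q \<in> Q" for p q
      unfolding X_def using that by (intro single_in_poly_ring) auto
    have hX: "h (X (p, q) * ?u \<phi>) = ?I +>\<^bsub>?R\<^esub> (X (p, q) * g \<phi>)"
      if "p \<in> P" "q \<in> Q" "\<phi> \<in> P \<rightarrow>\<^sub>E Q" for p q \<phi>
      using Hom_quot_smult[OF h XR uI, OF that] ring_hom_mult[OF ideal.rcos_ring_hom[OF I] XR gR, OF that]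
      by (simp add: hg that)
    \<comment> \<open>Comes from the syzygy between \<open>?u \<phi>\<close> and
      \<open>?u (\<phi>(p := q))\<close>: multiplying each by the variable that the other has in row
      \<open>p\<close> gives the same monomial.\<close>
    have exchange: "lookup (X (p, q) * g \<phi>) n = lookup (X (p, \<phi> p) * g (\<phi>(p := q))) n"
      if p: "p \<in> P" and q: "q \<in> Q" and \<phi>: "\<phi> \<in> P \<rightarrow>\<^sub>E Q" and n: "n \<notin> ?M" for p q \<phi> n
    proof -
      let ?\<phi>' = "\<phi>(p := q)"
      have \<phi>': "?\<phi>' \<in> P \<rightarrow>\<^sub>E Q" and \<phi>p: "\<phi> p \<in> Q" using p q \<phi> by (auto simp: PiE_def extensional_def)
      have "X (p, q) * ?u \<phi> = X (p, \<phi> p) * ?u ?\<phi>'"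
      proof -
        have "(\<Prod>x\<in>P - {p}. X (x, ?\<phi>' x) :: ('p \<times> 'q, 'k) mpoly) = (\<Prod>x\<in>P - {p}. X (x, \<phi> x))"
          by (rule prod.cong) auto
        then show ?thesis
          unfolding isotone_monomial_def using p fin(1) by (simp add: prod.remove[of P p] mult.left_commute)
      qed
      then have "?I +>\<^bsub>?R\<^esub> (X (p, q) * g \<phi>) = ?I +>\<^bsub>?R\<^esub> (X (p, \<phi> p) * g ?\<phi>')"
        using hX[OF p q \<phi>] hX[OF p \<phi>p \<phi>'] by simp
      then have "X (p, q) * g \<phi> - X (p, \<phi> p) * g ?\<phi>' \<in> ?I"
        using poly_ring_closed(2)[OF XR[OF p q] gR[OF \<phi>]] poly_ring_closed(2)[OF XR[OF p \<phi>p] gR[OF \<phi>']]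
        by (simp add: ideal.a_r_coset_eq_iff[OF I] poly_ring_minus)
      then have "n \<notin> keys (X (p, q) * g \<phi> - X (p, \<phi> p) * g ?\<phi>')"
        using n mem_isotone_ideal_iff[OF fin(1)] by blast
      then have "lookup (X (p, q) * g \<phi> - X (p, \<phi> p) * g ?\<phi>') n = 0" by (simp add: in_keys_iff)
      then show ?thesis by (simp add: lookup_minus)
    qed
    have X_add: "lookup (X v * f) (single v 1 + m) = lookup f m" for v m and f :: "('p \<times> 'q, 'k) mpoly"
      unfolding X_def by (simp only: lookup_single_mult mult_1)
    have divides: "0 < lookup n (p, \<phi> p)"
      if nz: "lookup (g \<phi>) n \<noteq> 0" and \<phi>: "\<phi> \<in> P \<rightarrow>\<^sub>E Q" and p0: "p0 \<in> P" "\<And>q. q \<in> Q \<Longrightarrow> lookup n (p0, q) = 0"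
        and p: "p \<in> P" "p \<noteq> p0" for \<phi> n p p0
    proof (rule ccontr)
      assume no: "\<not> 0 < lookup n (p, \<phi> p)"
      \<comment> \<open>A second value \<open>q\<close> is available since \<open>Q\<close> has at
        least two elements. Exchanging \<open>\<phi> p\<close> for \<open>q\<close> turns
        \<open>X (p, q) * g \<phi>\<close> into a multiple of \<open>X (p, \<phi> p)\<close>, a
        variable that does not occur in \<open>?n\<close>.\<close>
      have "\<not> Q \<subseteq> {\<phi> p}" using Q card_mono[of "{\<phi> p}" Q] by auto
      then obtain q where q: "q \<in> Q" "q \<noteq> \<phi> p" by blast
      let ?n = "single (p, q) 1 + n"
      have "lookup ?n (p0, c) = 0" if "c \<in> Q" for c
        using p0(2)[OF that] p by (auto simp: lookup_add lookup_single when_def)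
      then have "?n \<notin> ?M" using p0(1) by (force simp: M)
      moreover have "lookup (X (p, \<phi> p) * g (\<phi>(p := q))) ?n = 0"
        unfolding X_def using no q by (intro lookup_single_mult_eq_0)
          (auto simp: poly_mapping_eq_iff fun_eq_iff lookup_add lookup_single when_def intro!: exI[of _ p] exI[of _ "\<phi> p"])
      ultimately show False using exchange[OF p(1) q(1) \<phi>, of ?n] nz X_add by simp
    qed
    have step: "lookup (g \<phi>) (graph_exponent (P - {p0}) \<phi> + k) =
        lookup (g (\<phi>(p := q))) (graph_exponent (P - {p0}) (\<phi>(p := q)) + k)"
      if \<phi>: "\<phi> \<in> P \<rightarrow>\<^sub>E Q" and p0: "p0 \<in> P" "\<And>q. q \<in> Q \<Longrightarrow> lookup k (p0, q) = 0"
        and p: "p \<in> P" "p \<noteq> p0" and q: "q \<in> Q" for \<phi> p q p0 k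
    proof -
      define U where "U = graph_exponent (P - {p0} - {p}) \<phi>"
      have "graph_exponent (P - {p0} - {p}) (\<phi>(p := q)) = U"
        unfolding U_def graph_exponent_def by (rule sum.cong) auto
      then have U: "graph_exponent (P - {p0}) \<phi> = single (p, \<phi> p) 1 + U"
        "graph_exponent (P - {p0}) (\<phi>(p := q)) = single (p, q) 1 + U"
        using graph_exponent_remove[of "P - {p0}" p \<phi>] graph_exponent_remove[of "P - {p0}" p "\<phi>(p := q)"]
          fin(1) p by (simp_all add: U_def)
      \<comment> \<open>At this exponent \<open>X (p, q)\<close> cancels on one side of
        \<open>exchange\<close> and \<open>X (p, \<phi> p)\<close> on the other, leaving the two
        coefficients to be compared.\<close>
      let ?n = "single (p, q) 1 + (single (p, \<phi> p) 1 + U + k)"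
      have n: "?n = single (p, \<phi> p) 1 + (single (p, q) 1 + U + k)" by (simp only: ac_simps)
      have "lookup U (p0, c) = 0" for c
        unfolding U_def using fin(1) by (subst lookup_graph_exponent) auto
      then have "lookup ?n (p0, c) = 0" if "c \<in> Q" for c
        using p0(2)[OF that] p by (auto simp: lookup_add lookup_single when_def)
      then have "?n \<notin> ?M" using p0(1) by (force simp: M)
      from exchange[OF p(1) q \<phi> this] show ?thesis
        unfolding U by (subst (asm) (2) n) (simp only: X_add)
    qed
    have independent: "lookup (g \<phi>) (graph_exponent (P - {p0}) \<phi> + k) =
        lookup (g \<psi>) (graph_exponent (P - {p0}) \<psi> + k)"
      if \<phi>: "\<phi> \<in> P \<rightarrow>\<^sub>E Q" and \<psi>: "\<psi> \<in> P \<rightarrow>\<^sub>E Q" and p0: "p0 \<in> P" "\<And>q. q \<in> Q \<Longrightarrow> lookup k (p0, q) = 0"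
        and eq: "\<phi> p0 = \<psi> p0" for \<phi> \<psi> p0 k
    proof -
      \<comment> \<open>\<open>\<phi>\<close> is turned into \<open>\<psi>\<close> one row at a
        time; \<open>A\<close> contains the rows where they may still differ.\<close>
      have "lookup (g \<phi>) (graph_exponent (P - {p0}) \<phi> + k) =
          lookup (g \<psi>) (graph_exponent (P - {p0}) \<psi> + k)"
        if "finite A" "A \<subseteq> P - {p0}" "\<phi> \<in> P \<rightarrow>\<^sub>E Q" "\<forall>x\<in>P - A. \<phi> x = \<psi> x" for A \<phi>
        using that
      proof (induction A arbitrary: \<phi>)
        case empty
        then have "\<phi> = \<psi>" using \<psi> by (intro PiE_ext[of \<phi> P "\<lambda>_. Q"]) auto
        then show ?case by simp
      next
        case (insert p A)
        let ?\<phi>' = "\<phi>(p := \<psi> p)"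
        have p: "p \<in> P" "p \<noteq> p0" "\<psi> p \<in> Q" using insert.prems \<psi> by auto
        have "?\<phi>' \<in> P \<rightarrow>\<^sub>E Q" using insert.prems p by (auto simp: PiE_def extensional_def)
        moreover have "A \<subseteq> P - {p0}" "\<forall>x\<in>P - A. ?\<phi>' x = \<psi> x" using insert.prems by auto
        ultimately show ?case
          by (intro trans[OF step[OF insert.prems(2) p0 p] insert.IH])
      qed
      from this[of "P - {p0}" \<phi>] show ?thesis using fin(1) \<phi> eq p0 by auto
    qed
    \<comment> \<open>The value prescribed on the variable \<open>(p, q)\<close> is the quotient of
      \<open>g\<close> by the remaining factors of the monomial. The constant map is one choice
      among the maps sending \<open>p\<close> to \<open>q\<close>; by \<open>independent\<close>
      another choice gives the same coefficients at exponents without row \<open>p\<close>.\<close>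
    define d where "d = (\<lambda>(p, q). contract (graph_exponent (P - {p}) (\<lambda>x\<in>P. q)) (g (\<lambda>x\<in>P. q)))"
    define D where "D = (\<lambda>f\<in>carrier ?R. \<Sum>v\<in>?V. d v * partial_deriv v f)"
    have "d ` ?V \<subseteq> carrier ?R"
      by (auto simp: d_def intro!: contract_in_poly_ring gR)
    then have D: "D \<in> derivations ?V"
      unfolding D_def by (rule sum_partial_deriv_in_derivations)
    then have k: "delta_star ?V ?I D \<in> Hom_quot ?R ?I" by (rule delta_star_in_Hom_quot[OF I])
    have "h (?u \<phi>) = delta_star ?V ?I D (?u \<phi>)" if \<phi>: "\<phi> \<in> P \<rightarrow>\<^sub>E Q" for \<phi>
    proof -
      have DR: "D (?u \<phi>) \<in> carrier ?R" using D uR[OF \<phi>] by (auto simp: derivations_def Let_def)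
      have "lookup (D (?u \<phi>)) n = lookup (g \<phi>) n" if n: "n \<notin> ?M" for n
      proof -
        obtain p0 where "p0 \<in> P" "\<forall>q\<in>Q. lookup n (p0, q) = 0"
          using n by (auto simp: M)
        then have p0: "p0 \<in> P" "\<And>q. q \<in> Q \<Longrightarrow> lookup n (p0, q) = 0" by auto
        let ?U = "graph_exponent (P - {p0}) \<phi>" and ?q = "\<phi> p0"
        have q: "(\<lambda>x\<in>P. ?q) \<in> P \<rightarrow>\<^sub>E Q" using \<phi> p0 by auto
        have "lookup (D (?u \<phi>)) n = lookup (single ?U 1 * d (p0, ?q)) n"
          unfolding D_def using uR[OF \<phi>] \<phi> p0
          by (simp add: lookup_sum_partial_deriv_isotone_monomial[OF fin, of p0] PiE_def Pi_def image_subset_iff)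
        also have "\<dots> = lookup (g \<phi>) n"
        proof (cases "\<exists>m. n = ?U + m")
          case True
          then obtain m where m: "n = ?U + m" by blast
          then have "lookup m (p0, c) = 0" if "c \<in> Q" for c
            using p0(2)[OF that] by (simp add: lookup_add)
          then have "lookup (g (\<lambda>x\<in>P. ?q)) (graph_exponent (P - {p0}) (\<lambda>x\<in>P. ?q) + m) = lookup (g \<phi>) n"
            unfolding m using p0(1) by (intro independent[OF q \<phi>]) auto
          then show ?thesis by (simp only: m lookup_single_mult) (simp add: d_def lookup_contract)
        next
          case False
          \<comment> \<open>By \<open>divides\<close>, a nonzero coefficient would make
            \<open>?U\<close> divide \<open>n\<close>.\<close>
          have "lookup (g \<phi>) n = 0"
          proof (rule ccontr)
            assume "lookup (g \<phi>) n \<noteq> 0"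
            from divides[OF this \<phi> p0] have "lookup ?U v \<le> lookup n v" for v
              using fin(1) by (cases v) (auto simp: lookup_graph_exponent Suc_le_eq)
            then show False using poly_mapping_add_diff[of ?U n] False by metis
          qed
          then show ?thesis using False by (simp add: lookup_single_mult_eq_0)
        qed
        finally show ?thesis .
      qed
      \<comment> \<open>Agreement of all coefficients outside \<open>?M\<close> means that the
        difference is supported on exponents of the ideal.\<close>
      then have "keys (g \<phi> - D (?u \<phi>)) \<subseteq> ?M" by (force simp: in_keys_iff lookup_minus)
      moreover have "g \<phi> + - D (?u \<phi>) \<in> carrier ?R" by (rule poly_ring_closed(1)[OF gR[OF \<phi>] poly_ring_uminus_closed[OF DR]])
      ultimately have "g \<phi> - D (?u \<phi>) \<in> ?I"
        using mem_isotone_ideal_iff[OF fin(1)] by (metis diff_conv_add_uminus)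
      then show ?thesis
        using hg[OF \<phi>] uI[OF \<phi>] gR[OF \<phi>] DR
        by (simp add: delta_star_def ideal.a_r_coset_eq_iff[OF I] poly_ring_minus)
    qed
    then have "h = delta_star ?V ?I D"
      using h k uR unfolding isotone_ideal_def maps
      by (intro Hom_quot_eqI[OF poly_ring_cring]) auto
    then show ?thesis using D by blast
  qed
  then show ?thesis unfolding rigid_iff[OF I] by blast
qed

theorem theorem2p12:
  fixes P :: "'p::order set" and Q :: "'q::order set"
  assumes "finite P" and "finite Q" and "2 \<le> card Q"
  shows "rigid (P \<times> Q) (isotone_ideal P Q :: ('p \<times> 'q, 'k::field) mpoly set) \<longleftrightarrow>
    (\<forall>p\<in>P. \<forall>p'\<in>P. p \<noteq> p' \<longrightarrow> \<not> (p \<le> p' \<or> p' \<le> p))"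
proof
  assume r: "rigid (P \<times> Q) (isotone_ideal P Q :: ('p \<times> 'q, 'k) mpoly set)"
  have "Q \<noteq> {}" using assms(3) by auto
  from not_rigid_if_comparable[OF assms(1,2) this] r
  have "\<not> p < p'" if "p \<in> P" "p' \<in> P" for p p' using that by blast
  then show "\<forall>p\<in>P. \<forall>p'\<in>P. p \<noteq> p' \<longrightarrow> \<not> (p \<le> p' \<or> p' \<le> p)" by (auto simp: less_le)
qed (rule rigid_if_antichain[OF assms])

end
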